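(* (1) For every integer $n\ge1$, $$\left\lfloor\left(\sum_{k=n}^\infty\frac{(-1)^k}{B_{2k}^2}\right)^{-1}\right\rfloor=\begin{cases}B_{2n}^2+B_{2n-2}^2&\text{if $n$ is even},\\ -(B_{2n}^2+B_{2n-2}^2+1)&\text{if $n$ is odd}.\end{cases}$$ (2) For every integer $n\ge2$, $$\left\lfloor\left(\sum_{k=n}^\infty\frac{(-1)^k}{B_{2k-1}^2}\right)^{-1}\right\rfloor=\begin{cases}B_{2n-1}^2+B_{2n-3}^2&\text{if $n$ is even},\\ -(B_{2n-1}^2+B_{2n-3}^2+1)&\text{if $n$ is odd}.\end{cases}$$ (3) For every integer $n\ge1$, $$\left\lfloor\left(\sum_{k=n}^\infty\frac{(-1)^k}{B_{2k-1}B_{2k+1}}\right)^{-1}\right\rfloor=\begin{cases}B_{2n}^2+B_{2n-2}^2-1&\text{if $n$ is even},\\ -(B_{2n}^2+B_{2n-2}^2)&\text{if $n$ is odd}.\end{cases}$$ (4) For every integer $n\ge1$, $$\left\lfloor\left(\sum_{k=n}^\infty\frac{(-1)^k}{B_{2k}B_{2k+2}}\right)^{-1}\right\rfloor=\begin{cases}B_{2n+1}^2+B_{2n-1}^2-1&\text{if $n$ is even},\\ -(B_{2n+1}^2+B_{2n-1}^2)&\text{if $n$ is odd}.\end{cases}$$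
   Context: The balancing numbers are defined by $B_0=0$, $B_1=1$, $B_n=6B_{n-1}-B_{n-2}$ for $n\ge 2$ (only nonnegative indices are used). $\lfloor x\rfloor$ denotes the floor of a real number $x$. *)

theory Defs
  imports Complex_Main
begin

(* Integer-valued, so that the subtraction in the recurrence does not truncate. *)
fun balancing :: "nat \<Rightarrow> int" where
  "balancing 0 = 0"
| "balancing (Suc 0) = 1"
| "balancing (Suc (Suc n)) = 6 * balancing (Suc n) - balancing n"

end

theory Submission
  imports Defs
begin

text \<open>
  Put \<open>u k = B (m + 2 k)\<close>, \<open>D k = (u (k + 1))\<^sup>2 - s\<close> with \<open>s \<in> {0, 1}\<close>; by the Cassini identity
  \<open>B j * B (j + 2) = (B (j + 1))\<^sup>2 - 1\<close> all four sums are tails of \<open>\<Sum> (-1)\<^sup>k / D k\<close>.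
  The trial values \<open>g k = 1 / ((u k)\<^sup>2 + (u (k + 1))\<^sup>2 + h)\<close> satisfy
  \<open>g 0 = \<Sum> (-1)\<^sup>k (g k + g (k + 1))\<close>, so \<open>g 0 - \<Sum> (-1)\<^sup>k / D k\<close> is the alternating sum of the
  defects \<open>g k + g (k + 1) - 1 / D k\<close>. These have constant sign and decreasing size, so
  that sum has the sign of the defects: positive for \<open>h = - s\<close>, negative for \<open>h = 1 - s\<close>.
\<close>

section \<open>Alternating series with decreasing terms\<close>

lemma alternating_telescope_sums:
  fixes g :: "nat \<Rightarrow> real"
  assumes "g \<longlonglongrightarrow> 0"
  shows "(\<lambda>j. (-1) ^ j * (g j + g (Suc j))) sums g 0"
proof -
  have "(\<lambda>j. (-1) ^ j * g j) \<longlonglongrightarrow> 0"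
    by (rule tendsto_rabs_zero_cancel) (use tendsto_rabs_zero[OF assms] in \<open>simp add: abs_mult\<close>)
  from telescope_sums'[OF this] show ?thesis
    by (simp add: algebra_simps)
qed

text \<open>By Leibniz, the partial sum of the first two terms, \<open>d 0 - d 1\<close>, bounds the
  whole sum from below; strict decrease makes this bound positive.\<close>

lemma alternating_sums_pos:
  fixes d :: "nat \<Rightarrow> real"
  assumes "d \<longlonglongrightarrow> 0" and pos: "\<And>j. 0 < d j" and dec: "\<And>j. d (Suc j) < d j"
  obtains S where "(\<lambda>j. (-1) ^ j * d j) sums S" and "0 < S"
proof -
  have "monoseq d"
    by (intro decseq_imp_monoseq decseq_SucI less_imp_le dec)
  note leibniz = summable_Leibniz[OF assms(1) this]
  have "(\<Sum>i<2 * 1. (-1) ^ i * d i) \<le> (\<Sum>i. (-1) ^ i * d i)"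
    using leibniz(2)[rule_format, OF pos, of 1] by simp
  then have "0 < (\<Sum>i. (-1) ^ i * d i)"
    using dec[of 0] by (simp add: numeral_2_eq_2)
  with summable_sums[OF leibniz(1)] show thesis
    by (rule that)
qed

text \<open>The sign \<sigma> selects the direction, so that upper and lower estimates of the sum
  share one proof: \<sigma> = 1 makes \<open>g 0\<close> an overestimate, \<sigma> = -1 an
  underestimate.\<close>

lemma alternating_sums_compare:
  fixes f g :: "nat \<Rightarrow> real" and \<sigma> :: real
  assumes "f \<longlonglongrightarrow> 0" and "g \<longlonglongrightarrow> 0" and \<sigma>: "\<sigma> = 1 \<or> \<sigma> = - 1"
    and "\<And>j. 0 < \<sigma> * (g j + g (Suc j) - f j)"
    and "\<And>j. \<sigma> * (g (Suc j) + g (Suc (Suc j)) - f (Suc j)) < \<sigma> * (g j + g (Suc j) - f j)"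
  obtains T where "(\<lambda>j. (-1) ^ j * f j) sums T" and "0 < \<sigma> * (g 0 - T)"
proof -
  let ?d = "\<lambda>j. \<sigma> * (g j + g (Suc j) - f j)"
  have "?d \<longlonglongrightarrow> \<sigma> * (0 + 0 - 0)"
    by (intro tendsto_intros assms(1,2) LIMSEQ_Suc)
  then have "?d \<longlonglongrightarrow> 0" by simp
  then obtain S where S: "(\<lambda>j. (-1) ^ j * ?d j) sums S" "0 < S"
    using alternating_sums_pos[of ?d] assms(4,5) by blast
  \<comment> \<open>The series of \<open>f\<close> is recovered as the telescoping series minus the
    defect series, because \<sigma> squared is 1.\<close>
  have "(\<lambda>j. (-1) ^ j * (g j + g (Suc j)) - \<sigma> * ((-1) ^ j * ?d j)) sums (g 0 - \<sigma> * S)"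
    by (intro sums_diff sums_mult alternating_telescope_sums assms(2) S(1))
  moreover have "(-1) ^ j * (g j + g (Suc j)) - \<sigma> * ((-1) ^ j * ?d j) = (-1) ^ j * f j" for j
    using \<sigma> by (auto simp: algebra_simps)
  ultimately have "(\<lambda>j. (-1) ^ j * f j) sums (g 0 - \<sigma> * S)" by simp
  then show thesis
    by (rule that) (use \<sigma> S(2) in auto)
qed

section \<open>The defects along a quadratic recurrence\<close>

text \<open>The numerator is symmetric in the squares of \<open>p\<close> and \<open>r\<close>,
  whose product and sum are polynomials in \<open>q\<close>: \<open>p * r\<close> is given, and
  squaring \<open>p + r = 34 * q\<close> yields the sum. The fourth powers of \<open>q\<close>
  cancel, so the numerator is only linear in the square of \<open>q\<close>.\<close>

lemma defect_eq:
  fixes p q r s h :: real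
  assumes "p * r = q\<^sup>2 - 36" and "r = 34 * q - p"
    and "p\<^sup>2 + q\<^sup>2 + h \<noteq> 0" and "q\<^sup>2 + r\<^sup>2 + h \<noteq> 0" and "q\<^sup>2 - s \<noteq> 0"
  shows "inverse (p\<^sup>2 + q\<^sup>2 + h) + inverse (q\<^sup>2 + r\<^sup>2 + h) - inverse (q\<^sup>2 - s)
    = ((72 - 2 * s) * q\<^sup>2 - 1296 + s\<^sup>2 - (h + s) * (1154 * q\<^sup>2 + 72) - (h + s)\<^sup>2)
      / ((q\<^sup>2 - s) * (p\<^sup>2 + q\<^sup>2 + h) * (q\<^sup>2 + r\<^sup>2 + h))"
proof -
  define L M D where "L = p\<^sup>2 + q\<^sup>2 + h" and "M = q\<^sup>2 + r\<^sup>2 + h" and "D = q\<^sup>2 - s"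
  have pr: "p\<^sup>2 * r\<^sup>2 = (q\<^sup>2 - 36)\<^sup>2"
    using assms(1) by (metis power_mult_distrib)
  have "(p + r)\<^sup>2 = (34 * q)\<^sup>2" using assms(2) by simp
  then have sum: "p\<^sup>2 + r\<^sup>2 = 1154 * q\<^sup>2 + 72"
    using assms(1) by (simp add: power2_sum power_mult_distrib)
  have "D * (L + M) - L * M = (q\<^sup>2 - s)\<^sup>2 - p\<^sup>2 * r\<^sup>2 - (h + s) * (p\<^sup>2 + r\<^sup>2) - (h + s)\<^sup>2"
    by (simp add: L_def M_def D_def algebra_simps power2_eq_square)
  also have "\<dots> = (72 - 2 * s) * q\<^sup>2 - 1296 + s\<^sup>2 - (h + s) * (1154 * q\<^sup>2 + 72) - (h + s)\<^sup>2"
    unfolding pr sum by (simp add: algebra_simps power2_eq_square)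
  finally have N: "D * (L + M) - L * M = \<dots>" .
  have "L \<noteq> 0" "M \<noteq> 0" "D \<noteq> 0"
    using assms(3-5) by (simp_all only: L_def M_def D_def not_False_eq_True)
  then have "inverse L + inverse M - inverse D = (D * (L + M) - L * M) / (D * L * M)"
    by (simp add: field_simps)
  then show ?thesis unfolding N unfolding L_def M_def D_def .
qed

text \<open>This models every second balancing number, from an even or an odd start. The step is 34
  = 6^2 - 2, and 36 is the value of the form x^2 - 34xy + y^2 at consecutive terms.\<close>

locale quadratic_orbit =
  fixes u :: "nat \<Rightarrow> real"
  assumes nonneg0: "0 \<le> u 0" and ge6: "6 \<le> u (Suc 0)" and growth0: "6 * u 0 \<le> u (Suc 0)"
    and rec: "\<And>k. u (Suc (Suc k)) = 34 * u (Suc k) - u k"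
    and inv0: "(u (Suc 0))\<^sup>2 - 34 * u (Suc 0) * u 0 + (u 0)\<^sup>2 = 36"
begin

lemma growth: "0 \<le> u k \<and> 6 * u k \<le> u (Suc k) \<and> 6 \<le> u (Suc k)"
  by (induction k) (use nonneg0 ge6 growth0 in \<open>auto simp: rec\<close>)

text \<open>The recurrence preserves the quadratic form of \<open>inv0\<close>, and eliminating
  \<open>34 * u (Suc k)\<close> turns that invariant into a product formula.\<close>

lemma prod_eq: "u k * u (Suc (Suc k)) = (u (Suc k))\<^sup>2 - 36"
proof -
  have "(u (Suc k))\<^sup>2 - 34 * u (Suc k) * u k + (u k)\<^sup>2 = 36"
  proof (induction k)
    case (Suc k)
    then show ?case by (simp add: rec power2_eq_square algebra_simps)
  qed (rule inv0)
  then show ?thesis by (simp add: rec power2_eq_square algebra_simps)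
qed

lemma square_growth: "36 * (u k)\<^sup>2 \<le> (u (Suc k))\<^sup>2" "36 \<le> (u (Suc k))\<^sup>2" "0 \<le> (u k)\<^sup>2"
proof -
  have "(6 * u k)\<^sup>2 \<le> (u (Suc k))\<^sup>2" "6\<^sup>2 \<le> (u (Suc k))\<^sup>2"
    using growth[of k] by (intro power_mono; simp)+
  then show "36 * (u k)\<^sup>2 \<le> (u (Suc k))\<^sup>2" "36 \<le> (u (Suc k))\<^sup>2"
    by (simp_all add: power_mult_distrib)
qed simp

lemma filterlim_square: "filterlim (\<lambda>k. (u (Suc k))\<^sup>2) at_top sequentially"
proof (rule filterlim_at_top_mono)
  show "filterlim real at_top sequentially"
    by (rule filterlim_real_sequentially)
  have "real k \<le> (u (Suc k))\<^sup>2" for k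
  proof (induction k)
    case (Suc k)
    then show ?case using square_growth(1,2)[of "Suc k"] by simp
  qed simp
  then show "\<forall>\<^sub>F k in sequentially. real k \<le> (u (Suc k))\<^sup>2" by simp
qed

text \<open>For \<open>h = - s\<close> the terms with \<open>h + s\<close> vanish from the defect
  numerator, leaving it positive; for \<open>h = 1 - s\<close> the term -1154 q^2 dominates and
  makes it negative.\<close>

lemma alternating_sum_compare:
  fixes s h \<sigma> :: real
  assumes s: "s = 0 \<or> s = 1" and cases: "\<sigma> = 1 \<and> h = - s \<or> \<sigma> = - 1 \<and> h = 1 - s"
  obtains T where "(\<lambda>j. (-1) ^ j * inverse ((u (Suc j))\<^sup>2 - s)) sums T"
    and "0 < \<sigma> * (inverse ((u 0)\<^sup>2 + (u (Suc 0))\<^sup>2 + h) - T)"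
proof -
  define Q where "Q j = (u j)\<^sup>2" for j
  define D where "D j = Q (Suc j) - s" for j
  define L where "L j = Q j + Q (Suc j) + h" for j
  define N where "N j = \<sigma> * ((72 - 2 * s) * Q (Suc j) - 1296 + s\<^sup>2
      - (h + s) * (1154 * Q (Suc j) + 72) - (h + s)\<^sup>2)" for j
  have h: "- 1 \<le> h" "h \<le> 1" and \<sigma>: "\<sigma> = 1 \<or> \<sigma> = - 1" using s cases by auto
  have Q: "36 * Q j \<le> Q (Suc j)" "36 \<le> Q (Suc j)" "0 \<le> Q j" for j
    using square_growth[of j] by (auto simp: Q_def)
  have D: "0 < D j" and L: "0 < L j" for j
    using Q[of j] s h by (auto simp: D_def L_def)
  have N: "0 < N j" "N (Suc j) * D j \<le> 3 * N j * D (Suc j)" for j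
  proof -
    \<comment> \<open>In both cases \<open>N / D\<close> stays between some \<open>c\<close> and
      \<open>3 * c\<close>, so it changes by a factor of at most 3 from one index to the next. Here
      1082 = 1154 - 72; the value 34 below relies on \<open>Q (Suc i)\<close> being at least
      36.\<close>
    have b2: "1082 * D i \<le> N i \<and> N i \<le> 3246 * D i" if "\<sigma> = - 1" for i
      using s cases that Q(2)[of i] by (auto simp: N_def D_def)
    have b1: "34 * D i \<le> N i \<and> N i \<le> 102 * D i" if "\<sigma> = 1" for i
      using s cases that Q(2)[of i] by (auto simp: N_def D_def)
    obtain c where c: "0 < c" "\<And>i. c * D i \<le> N i" "\<And>i. N i \<le> 3 * c * D i"
    proof (cases "\<sigma> = 1")
      case True
      show thesis by (rule that[of 34]) (use b1[OF True] in auto)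
    next
      case False
      then have "\<sigma> = - 1" using cases by auto
      show thesis by (rule that[of 1082]) (use b2[OF \<open>\<sigma> = - 1\<close>] in auto)
    qed
    show "0 < N j"
      using c(1) c(2)[of j] D[of j] by (meson less_le_trans mult_pos_pos)
    have "N (Suc j) * D j \<le> (3 * c * D (Suc j)) * D j"
      using c(3) D[of j] by (intro mult_right_mono) auto
    also have "\<dots> = (c * D j) * (3 * D (Suc j))" by simp
    also have "\<dots> \<le> N j * (3 * D (Suc j))"
      using c(2) D[of "Suc j"] by (intro mult_right_mono) auto
    finally show "N (Suc j) * D j \<le> 3 * N j * D (Suc j)" by simp
  qed
  have defect: "\<sigma> * (inverse (L j) + inverse (L (Suc j)) - inverse (D j))
      = N j / (D j * L j * L (Suc j))" for j
    using defect_eq[OF prod_eq[of j] rec[of j], of h s] L[of j] L[of "Suc j"] D[of j]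
    by (simp add: N_def Q_def L_def D_def)
  have dec: "N (Suc j) / (D (Suc j) * L (Suc j) * L (Suc (Suc j))) < N j / (D j * L j * L (Suc j))"
    for j
  proof -
    \<comment> \<open>Consecutive defects share the factor \<open>L (Suc j)\<close>. What remains is
      that the growth of \<open>L\<close> over two steps outweighs the possible factor 3 in
      \<open>N / D\<close>.\<close>
    have LL: "3 * L j < L (Suc (Suc j))"
      using Q[of j] Q[of "Suc j"] Q[of "Suc (Suc j)"] h by (simp add: L_def)
    have "N (Suc j) * D j * L j \<le> 3 * N j * D (Suc j) * L j"
      using N(2)[of j] L[of j] by (intro mult_right_mono) auto
    also have "\<dots> = (N j * D (Suc j)) * (3 * L j)" by simp
    also have "\<dots> < (N j * D (Suc j)) * L (Suc (Suc j))"
      using N(1)[of j] D[of "Suc j"] LL by (intro mult_strict_left_mono) auto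
    finally have "N (Suc j) / (D (Suc j) * L (Suc (Suc j))) < N j / (D j * L j)"
      using D[of j] D[of "Suc j"] L[of j] L[of "Suc (Suc j)"] by (simp add: field_simps)
    then have "N (Suc j) / (D (Suc j) * L (Suc (Suc j))) / L (Suc j) < N j / (D j * L j) / L (Suc j)"
      using L[of "Suc j"] by (rule divide_strict_right_mono)
    then show ?thesis by (simp add: mult_ac)
  qed
  have "filterlim D at_top sequentially"
    unfolding D_def Q_def diff_conv_add_uminus
    by (subst add.commute) (rule filterlim_tendsto_add_at_top[OF tendsto_const filterlim_square])
  then have D0: "(\<lambda>j. inverse (D j)) \<longlonglongrightarrow> 0"
    by (rule tendsto_inverse_0_at_top)
  have "filterlim L at_top sequentially"
  proof (rule filterlim_at_top_mono)
    show "filterlim (\<lambda>j. h + Q (Suc j)) at_top sequentially"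
      unfolding Q_def by (rule filterlim_tendsto_add_at_top[OF tendsto_const filterlim_square])
    show "\<forall>\<^sub>F j in sequentially. h + Q (Suc j) \<le> L j"
      using Q(3) by (simp add: L_def)
  qed
  then have L0: "(\<lambda>j. inverse (L j)) \<longlonglongrightarrow> 0"
    by (rule tendsto_inverse_0_at_top)
  show thesis
  proof (rule alternating_sums_compare[OF D0 L0 \<sigma>])
    show "0 < \<sigma> * (inverse (L j) + inverse (L (Suc j)) - inverse (D j))" for j
      unfolding defect using N(1)[of j] D[of j] L[of j] L[of "Suc j"] by simp
    show "\<sigma> * (inverse (L (Suc j)) + inverse (L (Suc (Suc j))) - inverse (D (Suc j)))
        < \<sigma> * (inverse (L j) + inverse (L (Suc j)) - inverse (D j))" for j
      unfolding defect by (rule dec)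
  next
    fix T
    assume "(\<lambda>j. (-1) ^ j * inverse (D j)) sums T" and "0 < \<sigma> * (inverse (L 0) - T)"
    then show thesis by (intro that) (simp_all add: D_def L_def Q_def)
  qed
qed

text \<open>Both choices of sign are applied to the same series, and uniqueness of its sum merges
  the two estimates. Positivity of \<open>T\<close> permits inverting them, which confines
  \<open>inverse T\<close> to an open interval of length 1.\<close>

lemma alternating_sum_bounds:
  fixes s :: real
  assumes s: "s = 0 \<or> s = 1"
  obtains T where "(\<lambda>j. (-1) ^ j * inverse ((u (Suc j))\<^sup>2 - s)) sums T"
    and "0 < T" "(u 0)\<^sup>2 + (u (Suc 0))\<^sup>2 - s < inverse T"
    and "inverse T < (u 0)\<^sup>2 + (u (Suc 0))\<^sup>2 + 1 - s"
proof -
  let ?c = "(u 0)\<^sup>2 + (u (Suc 0))\<^sup>2"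
  obtain T where T: "(\<lambda>j. (-1) ^ j * inverse ((u (Suc j))\<^sup>2 - s)) sums T" "T < inverse (?c - s)"
    using alternating_sum_compare[of s 1 "- s"] s by auto
  obtain T' where T': "(\<lambda>j. (-1) ^ j * inverse ((u (Suc j))\<^sup>2 - s)) sums T'"
      "inverse (?c + 1 - s) < T'"
    using alternating_sum_compare[of s "-1" "1 - s"] s by (auto simp: add_diff_eq)
  have "T' = T" using T(1) T'(1) by (rule sums_unique2[symmetric])
  have "s \<le> 1" using s by auto
  then have c: "0 < ?c - s"
    using square_growth(2)[of 0] square_growth(3)[of 0] by linarith
  have "0 < inverse (?c + 1 - s)" using c by simp
  then have "0 < T" using T'(2) unfolding \<open>T' = T\<close> by (rule less_trans)
  moreover have "?c - s < inverse T"
    using less_imp_inverse_less[OF T(2) \<open>0 < T\<close>] by simp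
  moreover have "inverse T < ?c + 1 - s"
    using less_imp_inverse_less[OF T'(2) \<open>0 < inverse (?c + 1 - s)\<close>] unfolding \<open>T' = T\<close> by simp
  ultimately show thesis using that T(1) by blast
qed

end

section \<open>Balancing numbers and the floor formulas\<close>

lemma balancing_step4: "balancing (m + 4) = 34 * balancing (m + 2) - balancing m"
  by (simp add: eval_nat_numeral)

lemma balancing_growth: "0 \<le> balancing m \<and> 2 * balancing m < balancing (Suc m)"
  by (induction m) auto

lemma balancing_growth2: "6 * balancing m \<le> balancing (m + 2)" "6 \<le> balancing (m + 2)"
proof -
  have "balancing (m + 2) = 6 * balancing (Suc m) - balancing m" by simp
  moreover have "2 * balancing m + 1 \<le> balancing (Suc m)" "0 \<le> balancing m"
    using balancing_growth[of m] by simp_all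
  ultimately show "6 * balancing m \<le> balancing (m + 2)" and "6 \<le> balancing (m + 2)"
    by - linarith+
qed

text \<open>The form x^2 - 6xy + y^2 is constant along the recurrence; it yields both the Cassini
  identity and the invariant for steps of two.\<close>

lemma balancing_invariant:
  "(balancing (Suc m))\<^sup>2 - 6 * balancing (Suc m) * balancing m + (balancing m)\<^sup>2 = 1"
proof (induction m)
  case (Suc m)
  then show ?case by (simp add: power2_eq_square algebra_simps)
qed simp

lemma balancing_cassini: "balancing m * balancing (m + 2) = (balancing (m + 1))\<^sup>2 - 1"
  using balancing_invariant[of m] by (simp add: power2_eq_square algebra_simps)

lemma balancing_invariant2:
  "(balancing (m + 2))\<^sup>2 - 34 * balancing (m + 2) * balancing m + (balancing m)\<^sup>2 = 36"
  using balancing_invariant[of m] by (simp add: power2_eq_square algebra_simps)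

declare balancing.simps(3) [simp del]

lemma quadratic_orbit_balancing: "quadratic_orbit (\<lambda>k. real_of_int (balancing (m + 2 * k)))"
proof
  show "(real_of_int (balancing (m + 2 * Suc 0)))\<^sup>2
      - 34 * real_of_int (balancing (m + 2 * Suc 0)) * real_of_int (balancing (m + 2 * 0))
      + (real_of_int (balancing (m + 2 * 0)))\<^sup>2 = 36"
    using arg_cong[OF balancing_invariant2[of m], of real_of_int] by simp
  show "real_of_int (balancing (m + 2 * Suc (Suc k))) =
      34 * real_of_int (balancing (m + 2 * Suc k)) - real_of_int (balancing (m + 2 * k))" for k
    using arg_cong[OF balancing_step4[of "m + 2 * k"], of real_of_int]
    by (simp add: eval_nat_numeral)
qed (use balancing_growth[of m] balancing_growth2[of m] in simp_all)

text \<open>The factor (-1)^n comes out of the sum. The interval for \<open>inverse T\<close> has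
  integer endpoints, both excluded: for even \<open>n\<close> the floor is the lower endpoint, for
  odd \<open>n\<close> it is the negative of the upper one. The parity of \<open>m\<close> and the
  value of \<open>s\<close> distinguish the four formulas.\<close>

lemma floor_alternating_balancing:
  fixes n m :: nat and s :: int
  assumes s: "s = 0 \<or> s = 1"
    and f: "\<And>k. f k = (real_of_int (balancing (m + 2 + 2 * k)))\<^sup>2 - real_of_int s"
  shows "\<lfloor>inverse (\<Sum>k. (-1) ^ (n + k) / f k)\<rfloor> =
    (if even n then (balancing (m + 2))\<^sup>2 + (balancing m)\<^sup>2 - s
     else - ((balancing (m + 2))\<^sup>2 + (balancing m)\<^sup>2 + 1 - s))"
proof -
  interpret quadratic_orbit "\<lambda>k. real_of_int (balancing (m + 2 * k))"
    by (rule quadratic_orbit_balancing)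
  have "real_of_int s = 0 \<or> real_of_int s = 1" using s by auto
  then obtain T where
    T: "(\<lambda>j. (-1) ^ j * inverse ((real_of_int (balancing (m + 2 * Suc j)))\<^sup>2 - real_of_int s)) sums T"
    and lo: "(real_of_int (balancing m))\<^sup>2 + (real_of_int (balancing (m + 2)))\<^sup>2 - s < inverse T"
    and hi: "inverse T < (real_of_int (balancing m))\<^sup>2 + (real_of_int (balancing (m + 2)))\<^sup>2 + 1 - s"
    by (rule alternating_sum_bounds) auto
  have "(\<lambda>k. (-1) ^ (n + k) / f k) sums ((-1) ^ n * T)"
    using sums_mult[OF T, of "(-1) ^ n"] by (simp add: f power_add divide_inverse mult.assoc)
  then have "(\<Sum>k. (-1) ^ (n + k) / f k) = (-1) ^ n * T"
    by (rule sums_unique[symmetric])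
  then show ?thesis using lo hi by (auto simp: floor_eq_iff)
qed

theorem theorem10:
  shows
    "(\<forall>n::nat. n \<ge> 1 \<longrightarrow>
        \<lfloor>inverse (\<Sum>k::nat. (-1) ^ (n + k) / (real_of_int (balancing (2 * (n + k))))\<^sup>2)\<rfloor> =
          (if even n then (balancing (2 * n))\<^sup>2 + (balancing (2 * n - 2))\<^sup>2
           else - ((balancing (2 * n))\<^sup>2 + (balancing (2 * n - 2))\<^sup>2 + 1)))
     \<and>
     (\<forall>n::nat. n \<ge> 2 \<longrightarrow>
        \<lfloor>inverse (\<Sum>k::nat. (-1) ^ (n + k) / (real_of_int (balancing (2 * (n + k) - 1)))\<^sup>2)\<rfloor> =
          (if even n then (balancing (2 * n - 1))\<^sup>2 + (balancing (2 * n - 3))\<^sup>2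
           else - ((balancing (2 * n - 1))\<^sup>2 + (balancing (2 * n - 3))\<^sup>2 + 1)))
     \<and>
     (\<forall>n::nat. n \<ge> 1 \<longrightarrow>
        \<lfloor>inverse (\<Sum>k::nat. (-1) ^ (n + k) /
            (real_of_int (balancing (2 * (n + k) - 1)) * real_of_int (balancing (2 * (n + k) + 1))))\<rfloor> =
          (if even n then (balancing (2 * n))\<^sup>2 + (balancing (2 * n - 2))\<^sup>2 - 1
           else - ((balancing (2 * n))\<^sup>2 + (balancing (2 * n - 2))\<^sup>2)))
     \<and>
     (\<forall>n::nat. n \<ge> 1 \<longrightarrow>
        \<lfloor>inverse (\<Sum>k::nat. (-1) ^ (n + k) /
            (real_of_int (balancing (2 * (n + k))) * real_of_int (balancing (2 * (n + k) + 2))))\<rfloor> =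
          (if even n then (balancing (2 * n + 1))\<^sup>2 + (balancing (2 * n - 1))\<^sup>2 - 1
           else - ((balancing (2 * n + 1))\<^sup>2 + (balancing (2 * n - 1))\<^sup>2)))"
proof (intro conjI allI impI)
  fix n :: nat
  assume "n \<ge> 1"
  then obtain m where n: "n = Suc m" by (cases n) auto
  show "\<lfloor>inverse (\<Sum>k::nat. (-1) ^ (n + k) / (real_of_int (balancing (2 * (n + k))))\<^sup>2)\<rfloor> =
          (if even n then (balancing (2 * n))\<^sup>2 + (balancing (2 * n - 2))\<^sup>2
           else - ((balancing (2 * n))\<^sup>2 + (balancing (2 * n - 2))\<^sup>2 + 1))"
    by (subst floor_alternating_balancing[where s = 0 and m = "2 * m"])
      (simp_all add: n algebra_simps)
  \<comment> \<open>Cassini centred at \<open>2 * (n + k)\<close> gives \<open>s = 1\<close> with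
    the same base index \<open>2 * n - 2\<close> as for the even squares.\<close>
  have cas3: "real_of_int (balancing (2 * (n + k) - 1)) * real_of_int (balancing (2 * (n + k) + 1))
      = (real_of_int (balancing (2 * m + 2 + 2 * k)))\<^sup>2 - real_of_int 1" for k
    using arg_cong[OF balancing_cassini[of "2 * (n + k) - 1"], of real_of_int]
    by (simp add: n algebra_simps)
  show "\<lfloor>inverse (\<Sum>k::nat. (-1) ^ (n + k) /
            (real_of_int (balancing (2 * (n + k) - 1)) * real_of_int (balancing (2 * (n + k) + 1))))\<rfloor> =
          (if even n then (balancing (2 * n))\<^sup>2 + (balancing (2 * n - 2))\<^sup>2 - 1
           else - ((balancing (2 * n))\<^sup>2 + (balancing (2 * n - 2))\<^sup>2))"
    by (subst floor_alternating_balancing[OF _ cas3]) (simp_all add: n)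
  \<comment> \<open>The centre is now \<open>2 * (n + k) + 1\<close>, so the base index is
    \<open>2 * n - 1\<close>.\<close>
  have cas4: "real_of_int (balancing (2 * (n + k))) * real_of_int (balancing (2 * (n + k) + 2))
      = (real_of_int (balancing (2 * m + 1 + 2 + 2 * k)))\<^sup>2 - real_of_int 1" for k
    using arg_cong[OF balancing_cassini[of "2 * (n + k)"], of real_of_int]
    by (simp add: n algebra_simps)
  show "\<lfloor>inverse (\<Sum>k::nat. (-1) ^ (n + k) /
            (real_of_int (balancing (2 * (n + k))) * real_of_int (balancing (2 * (n + k) + 2))))\<rfloor> =
          (if even n then (balancing (2 * n + 1))\<^sup>2 + (balancing (2 * n - 1))\<^sup>2 - 1
           else - ((balancing (2 * n + 1))\<^sup>2 + (balancing (2 * n - 1))\<^sup>2))"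
    by (subst floor_alternating_balancing[OF _ cas4]) (simp_all add: n)
next
  fix n :: nat
  assume "n \<ge> 2"
  then obtain m where n: "n = m + 2" by (metis add.commute le_Suc_ex)
  \<comment> \<open>The bound \<open>n \<ge> 2\<close> keeps the natural-number subtraction
    \<open>2 * n - 3\<close> from truncating.\<close>
  have idx: "2 * (n + k) - 1 = 2 * m + 1 + 2 + 2 * k" "2 * n - 1 = 2 * m + 1 + 2"
    "2 * n - 3 = 2 * m + 1" for k
    by (simp_all add: n)
  show "\<lfloor>inverse (\<Sum>k::nat. (-1) ^ (n + k) / (real_of_int (balancing (2 * (n + k) - 1)))\<^sup>2)\<rfloor> =
          (if even n then (balancing (2 * n - 1))\<^sup>2 + (balancing (2 * n - 3))\<^sup>2
           else - ((balancing (2 * n - 1))\<^sup>2 + (balancing (2 * n - 3))\<^sup>2 + 1))"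
    unfolding idx
    by (subst floor_alternating_balancing[where s = 0 and m = "2 * m + 1"]) simp_all
qed

end
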